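(* Let $G$ be a subgroup of $\mathrm{Gl}_n(\mathbb{C})$. If $G$ is nilpotent, torsion-free, and not abelian, then $G$ contains a non-diagonalizable element.
   Context: Diagonalizable means diagonalizable over $\mathbb{C}$, i.e. conjugate in $\mathrm{Gl}_n(\mathbb{C})$ to a diagonal matrix. *)

theory Defs
  imports "HOL-Algebra.Generated_Groups" "Jordan_Normal_Form.Matrix"
begin

definition GL :: "nat \<Rightarrow> complex mat monoid" where
  "GL n = units_of (ring_mat TYPE(complex) n ())"

definition diagonalizable :: "complex mat \<Rightarrow> bool" where
  "diagonalizable A \<longleftrightarrow> (\<exists>D. diagonal_mat D \<and> similar_mat A D)"

text \<open>The index is shifted by one with respect to the usual numbering
  \<open>\<gamma>\<^sub>1(G) = G\<close>, \<open>\<gamma>\<^sub>k\<^sub>+\<^sub>1(G) = [\<gamma>\<^sub>k(G), G]\<close>. The commutator convention is that of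
  \<^const>\<open>derived\<close>.\<close>

primrec lower_central_series :: "('a, 'b) monoid_scheme \<Rightarrow> nat \<Rightarrow> 'a set" where
  "lower_central_series G 0 = carrier G"
| "lower_central_series G (Suc k) =
     generate G (\<Union>x \<in> lower_central_series G k. \<Union>y \<in> carrier G.
       {x \<otimes>\<^bsub>G\<^esub> y \<otimes>\<^bsub>G\<^esub> inv\<^bsub>G\<^esub> x \<otimes>\<^bsub>G\<^esub> inv\<^bsub>G\<^esub> y})"

definition nilpotent_group :: "('a, 'b) monoid_scheme \<Rightarrow> bool" where
  "nilpotent_group G \<longleftrightarrow> group G \<and> (\<exists>k. lower_central_series G k = {\<one>\<^bsub>G\<^esub>})"

definition torsion_free_group :: "('a, 'b) monoid_scheme \<Rightarrow> bool" where
  "torsion_free_group G \<longleftrightarrow> group G \<and>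
     (\<forall>x \<in> carrier G. \<forall>k::nat. k > 0 \<longrightarrow> x [^]\<^bsub>G\<^esub> k = \<one>\<^bsub>G\<^esub> \<longrightarrow> x = \<one>\<^bsub>G\<^esub>)"

lemma group_GL: "group (GL n)"
  unfolding GL_def
  by (intro monoid.units_group ring.is_monoid ring_mat)

lemma carrier_GL: "carrier (GL n) = {A \<in> carrier_mat n n. invertible_mat A}"
proof -
  have "A \<in> Units (ring_mat TYPE(complex) n ()) \<longleftrightarrow> A \<in> carrier_mat n n \<and> invertible_mat A" for A
  proof
    assume "A \<in> Units (ring_mat TYPE(complex) n ())"
    then show "A \<in> carrier_mat n n \<and> invertible_mat A"
      by (auto simp: Units_def ring_mat_simps invertible_mat_def inverts_mat_def)
  next
    assume A: "A \<in> carrier_mat n n \<and> invertible_mat A"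
    then obtain B where AB: "A * B = 1\<^sub>m n" and BA: "B * A = 1\<^sub>m (dim_row B)"
      by (auto simp: invertible_mat_def inverts_mat_def)
    have "dim_col B = n" using arg_cong[OF AB, of dim_col] by simp
    moreover have "dim_row B = n" using arg_cong[OF BA, of dim_col] A by auto
    ultimately show "A \<in> Units (ring_mat TYPE(complex) n ())"
      using A AB BA by (auto simp: Units_def ring_mat_simps intro!: bexI[of _ B])
  qed
  then show ?thesis by (auto simp: GL_def units_of_carrier)
qed

end

theory Submission
  imports Defs "Jordan_Normal_Form.Determinant"
begin

text \<open>A nonabelian nilpotent group has a nontrivial central commutator \<open>z = [x, y]\<close>. On the
  eigenspace of \<open>z\<close> for an eigenvalue \<open>\<lambda>\<close> the element \<open>x y x\<^sup>-\<^sup>1 y\<^sup>-\<^sup>1\<close> acts as the scalar \<open>\<lambda>\<close>, and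
  taking determinants there gives \<open>\<lambda>\<^sup>d = 1\<close>, where \<open>d\<close> is the dimension of the eigenspace. Hence, if
  \<open>z\<close> is diagonalizable, then it has finite order, which torsion-freeness forbids.\<close>

lemma (in group) lower_central_series_incl: "lower_central_series G k \<subseteq> carrier G"
proof (induction k)
  case (Suc k)
  show ?case
    unfolding lower_central_series.simps by (rule generate_incl) (use Suc in auto)
qed simp

text \<open>The right-hand form is free of inverses, so it carries over directly to matrix products.
  With \<open>z = \<one>\<close> it says that \<open>x\<close> and \<open>y\<close> commute.\<close>

lemma (in group) commutator_eq_iff:
  assumes [simp]: "x \<in> carrier G" "y \<in> carrier G" "z \<in> carrier G"
  shows "x \<otimes> y \<otimes> inv x \<otimes> inv y = z \<longleftrightarrow> x \<otimes> y = z \<otimes> y \<otimes> x"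
  by (metis assms inv_closed inv_solve_right m_assoc m_closed)

text \<open>The last nontrivial term of the lower central series is central, because its commutators
  with \<open>G\<close> lie in the next term, which is trivial. Being itself generated by
  commutators, it has a nontrivial one among its generators.\<close>

lemma nilpotent_group_obtain_central_commutator:
  assumes "nilpotent_group G" "\<not> comm_group G"
  obtains x y z where "x \<in> carrier G" "y \<in> carrier G" "z \<in> carrier G" "z \<noteq> \<one>\<^bsub>G\<^esub>"
    "x \<otimes>\<^bsub>G\<^esub> y = z \<otimes>\<^bsub>G\<^esub> y \<otimes>\<^bsub>G\<^esub> x" "\<And>g. g \<in> carrier G \<Longrightarrow> z \<otimes>\<^bsub>G\<^esub> g = g \<otimes>\<^bsub>G\<^esub> z"
proof -
  interpret group G using assms(1) by (simp add: nilpotent_group_def)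
  let ?L = "lower_central_series G"
  define k where "k = (LEAST k. ?L k = {\<one>\<^bsub>G\<^esub>})"
  have k: "?L k = {\<one>\<^bsub>G\<^esub>}"
    using assms(1) unfolding k_def nilpotent_group_def by (metis (mono_tags, lifting) LeastI)
  have min: "?L j \<noteq> {\<one>\<^bsub>G\<^esub>}" if "j < k" for j
    using not_less_Least that unfolding k_def by blast
  have nc: "\<not> (\<forall>x\<in>carrier G. \<forall>y\<in>carrier G. x \<otimes>\<^bsub>G\<^esub> y = y \<otimes>\<^bsub>G\<^esub> x)"
    using assms(2) group_comm_groupI by blast
  \<comment> \<open>If already \<open>?L 0\<close>, the whole group, were trivial, then
    \<open>G\<close> would be abelian.\<close>
  have "k \<noteq> 0" using k nc by (intro notI) simp
  then obtain m where m: "k = Suc m" using not0_implies_Suc by blast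
  have central: "z \<otimes>\<^bsub>G\<^esub> g = g \<otimes>\<^bsub>G\<^esub> z" if z: "z \<in> ?L m" and g: "g \<in> carrier G" for z g
  proof -
    have zc: "z \<in> carrier G" using z lower_central_series_incl by blast
    have "z \<otimes>\<^bsub>G\<^esub> g \<otimes>\<^bsub>G\<^esub> inv\<^bsub>G\<^esub> z \<otimes>\<^bsub>G\<^esub> inv\<^bsub>G\<^esub> g \<in> ?L (Suc m)"
      using z g by (auto intro!: generate.incl)
    then have "z \<otimes>\<^bsub>G\<^esub> g \<otimes>\<^bsub>G\<^esub> inv\<^bsub>G\<^esub> z \<otimes>\<^bsub>G\<^esub> inv\<^bsub>G\<^esub> g = \<one>\<^bsub>G\<^esub>"
      using k m by auto
    then show ?thesis using zc g by (simp add: commutator_eq_iff)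
  qed
  \<comment> \<open>For \<open>m = 0\<close> centrality of \<open>?L m\<close> would make all of
    \<open>G\<close> commute. So \<open>?L m\<close> is a proper commutator term and has generators
    of the form \<open>[x, y]\<close>.\<close>
  have "m \<noteq> 0" using central nc by (intro notI) simp
  then obtain j where j: "m = Suc j" using not0_implies_Suc by blast
  let ?S = "\<Union>x \<in> ?L j. \<Union>y \<in> carrier G. {x \<otimes>\<^bsub>G\<^esub> y \<otimes>\<^bsub>G\<^esub> inv\<^bsub>G\<^esub> x \<otimes>\<^bsub>G\<^esub> inv\<^bsub>G\<^esub> y}"
  have L: "?L m = generate G ?S" using j by simp
  \<comment> \<open>Trivial generators would make \<open>?L m\<close> trivial, against the
    minimality of \<open>k\<close>.\<close>
  have "\<not> ?S \<subseteq> {\<one>\<^bsub>G\<^esub>}"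
  proof
    assume "?S \<subseteq> {\<one>\<^bsub>G\<^esub>}"
    then have "?S = {} \<or> ?S = {\<one>\<^bsub>G\<^esub>}" by (rule subset_singletonD)
    then have "?L m = {\<one>\<^bsub>G\<^esub>}" unfolding L
      by (elim disjE) (simp_all only: generate_empty generate_one)
    then show False using min m by blast
  qed
  then obtain z where z: "z \<in> ?S" "z \<noteq> \<one>\<^bsub>G\<^esub>" by blast
  then obtain x y where xy: "x \<in> ?L j" "y \<in> carrier G"
    and e: "z = x \<otimes>\<^bsub>G\<^esub> y \<otimes>\<^bsub>G\<^esub> inv\<^bsub>G\<^esub> x \<otimes>\<^bsub>G\<^esub> inv\<^bsub>G\<^esub> y" by blast
  have x: "x \<in> carrier G" using xy lower_central_series_incl by blast
  have zL: "z \<in> ?L m" unfolding L using z(1) by (rule generate.incl)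
  then have zc: "z \<in> carrier G" using lower_central_series_incl by blast
  have "x \<otimes>\<^bsub>G\<^esub> y = z \<otimes>\<^bsub>G\<^esub> y \<otimes>\<^bsub>G\<^esub> x"
    using e commutator_eq_iff[OF x xy(2) zc] by simp
  then show ?thesis by (rule that[OF x xy(2) zc z(2) _ central[OF zL]])
qed

text \<open>Commuting with a diagonal matrix means that entry \<open>(i,j)\<close> vanishes unless
  \<open>d i = d j\<close>, and applying \<open>f\<close> preserves such equalities. Taking
  indicator functions for \<open>f\<close> yields the projections onto eigenspaces.\<close>

lemma mat_diag_mult_commute:
  fixes X :: "'a :: idom mat"
  assumes X: "X \<in> carrier_mat n n" and c: "mat_diag n d * X = X * mat_diag n d"
  shows "mat_diag n (\<lambda>i. f (d i)) * X = X * mat_diag n (\<lambda>i. f (d i))"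
proof (rule eq_matI)
  fix i j assume "i < dim_row (X * mat_diag n (\<lambda>i. f (d i)))" "j < dim_col (X * mat_diag n (\<lambda>i. f (d i)))"
  then have ij: "i < n" "j < n" using X by (simp_all add: mat_diag_def)
  have "(mat_diag n d * X) $$ (i,j) = (X * mat_diag n d) $$ (i,j)" using c by simp
  then have "d i * X $$ (i,j) = X $$ (i,j) * d j"
    using X ij by (simp add: mat_diag_mult_left mat_diag_mult_right)
  then have "X $$ (i,j) = 0 \<or> d i = d j" by (auto simp: mult.commute)
  then show "(mat_diag n (\<lambda>i. f (d i)) * X) $$ (i,j) = (X * mat_diag n (\<lambda>i. f (d i))) $$ (i,j)"
    using X ij by (auto simp: mat_diag_mult_left mat_diag_mult_right)
qed (use X in \<open>simp_all add: mat_diag_def\<close>)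

lemma det_mat_diag: "det (mat_diag n d) = (\<Prod>i<n. d i)"
proof -
  have "det (mat_diag n d) = prod_list (diag_mat (mat_diag n d))"
    by (rule det_upper_triangular[of _ n]) (auto simp: upper_triangular_def mat_diag_def)
  also have "diag_mat (mat_diag n d) = map d [0..<n]"
    by (auto simp: diag_mat_def mat_diag_def)
  also have "prod_list \<dots> = (\<Prod>i<n. d i)"
    by (simp add: prod.distinct_set_conv_list[symmetric] atLeast0LessThan)
  finally show ?thesis .
qed

text \<open>Moving \<open>Y\<close> across \<open>P\<close> and \<open>F\<close> turns the cross
  terms into multiples of \<open>P * F\<close> and \<open>F * P\<close>, which vanish. Hence
  compressing to the image of \<open>P\<close> and adding \<open>F\<close> respects
  products.\<close>

lemma restrict_to_projection_mult:
  fixes X Y P F :: "'a :: idom mat"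
  assumes car: "X \<in> carrier_mat n n" "Y \<in> carrier_mat n n" "P \<in> carrier_mat n n"
      "F \<in> carrier_mat n n"
    and idem: "P * P = P" "F * F = F" "P * F = 0\<^sub>m n n" "F * P = 0\<^sub>m n n"
    and comm: "P * Y = Y * P" "F * Y = Y * F"
  shows "(X * P + F) * (Y * P + F) = X * Y * P + F"
proof -
  have "(X * P + F) * (Y * P + F) = (X * P + F) * (Y * P) + (X * P + F) * F"
    using car by (intro mult_add_distrib_mat[of _ n n _ n]) auto
  also have "(X * P + F) * (Y * P) = X * P * (Y * P) + F * (Y * P)"
    using car by (intro add_mult_distrib_mat[of _ n n _ _ n]) auto
  also have "X * P * (Y * P) = X * (P * Y) * P"
    using car by (simp add: assoc_mult_mat[of _ n n _ n _ n] mult_carrier_mat[of _ n n _ n])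
  also have "\<dots> = X * Y * (P * P)"
    unfolding comm using car by (simp add: assoc_mult_mat[of _ n n _ n _ n] mult_carrier_mat[of _ n n _ n])
  also have "F * (Y * P) = F * Y * P" using car by (simp add: assoc_mult_mat[of _ n n _ n _ n])
  also have "\<dots> = Y * (F * P)"
    unfolding comm using car by (simp add: assoc_mult_mat[of _ n n _ n _ n])
  also have "(X * P + F) * F = X * P * F + F * F"
    using car by (intro add_mult_distrib_mat[of _ n n _ _ n]) auto
  also have "X * P * F = X * (P * F)" using car by (simp add: assoc_mult_mat[of _ n n _ n _ n])
  finally show ?thesis using car by (simp add: idem)
qed

lemma central_commutator_mat_diag_root_of_unity:
  fixes d :: "nat \<Rightarrow> 'a :: idom"
  assumes car: "X \<in> carrier_mat n n" "Y \<in> carrier_mat n n" "X' \<in> carrier_mat n n" "Y' \<in> carrier_mat n n"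
    and inv: "X' * X = 1\<^sub>m n" "Y' * Y = 1\<^sub>m n"
    and cX: "mat_diag n d * X = X * mat_diag n d" and cY: "mat_diag n d * Y = Y * mat_diag n d"
    and XY: "X * Y = mat_diag n d * Y * X" and i: "i < n"
  shows "d i ^ card {j. j < n \<and> d j = d i} = 1"
proof -
  text \<open>\<open>P\<close> projects onto the eigenspace of the eigenvalue \<open>d i\<close>; \<open>\<lambda>A. A * P + F\<close> restricts to it
    the matrices that commute with \<open>P\<close>, keeping the identity on the complement.\<close>
  define P where "P = mat_diag n (\<lambda>j. if d j = d i then 1 else 0 :: 'a)"
  define F where "F = mat_diag n (\<lambda>j. if d j = d i then 0 else 1 :: 'a)"
  let ?D = "mat_diag n d"
  have P: "P \<in> carrier_mat n n" and F: "F \<in> carrier_mat n n" by (simp_all add: P_def F_def)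
  have idem: "P * P = P" "F * F = F" "P * F = 0\<^sub>m n n" "F * P = 0\<^sub>m n n" "P + F = 1\<^sub>m n"
    unfolding P_def F_def mat_diag_diag by (auto simp: mat_diag_def intro!: eq_matI)
  have comm: "P * A = A * P" "F * A = A * F"
    if "A \<in> carrier_mat n n" "?D * A = A * ?D" for A
    unfolding P_def F_def
    using mat_diag_mult_commute[OF that, of "\<lambda>t. if t = d i then 1 else 0"]
      mat_diag_mult_commute[OF that, of "\<lambda>t. if t = d i then 0 else 1"] by simp_all
  define R where "R A = A * P + F" for A
  have R: "R (A * B) = R A * R B"
    if "A \<in> carrier_mat n n" "B \<in> carrier_mat n n" "?D * B = B * ?D" for A B
    unfolding R_def
    using restrict_to_projection_mult[OF that(1,2) P F idem(1-4) comm[OF that(2,3)]] by simp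
  have R_car: "R A \<in> carrier_mat n n" if "A \<in> carrier_mat n n" for A
    using that P F by (simp add: R_def)
  have R_one: "R (1\<^sub>m n) = 1\<^sub>m n" using P idem(5) by (simp add: R_def)
  \<comment> \<open>Multiplicativity of \<open>R\<close> asks commutation with \<open>?D\<close> of
    the right factor, here \<open>A\<close>, so the left inverse \<open>B\<close> can be used as
    given.\<close>
  have det_R: "det (R A) \<noteq> 0"
    if A: "A \<in> carrier_mat n n" "?D * A = A * ?D" and B: "B \<in> carrier_mat n n" "B * A = 1\<^sub>m n" for A B
  proof -
    have "det (R B) * det (R A) = det (R (B * A))"
      using R[OF B(1) A] det_mult[OF R_car[OF B(1)] R_car[OF A(1)]] by simp
    also have "\<dots> = 1" using B(2) R_one by simp
    finally show ?thesis by auto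
  qed
  have D: "?D \<in> carrier_mat n n" by simp
  \<comment> \<open>Scalar \<open>d i\<close> on the eigenspace and 1 off it: the determinant is
    \<open>d i\<close> to the power of its multiplicity.\<close>
  have RD: "R ?D = mat_diag n (\<lambda>j. if d j = d i then d i else 1)"
    unfolding R_def P_def F_def mat_diag_diag by (auto simp: mat_diag_def intro!: eq_matI)
  have "R X * R Y = R (?D * Y * X)" using R[OF car(1,2) cY] XY by simp
  also have "\<dots> = R ?D * R Y * R X"
    using R[OF mult_carrier_mat[OF D car(2)] car(1) cX] R[OF D car(2) cY] by simp
  finally have "det (R X) * det (R Y) = det (R ?D) * det (R Y) * det (R X)"
    using det_mult R_car D car by (metis mult_carrier_mat)
  moreover have "det (R X) \<noteq> 0" "det (R Y) \<noteq> 0"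
    using det_R car inv cX cY by auto
  \<comment> \<open>The nonzero factors \<open>det (R X)\<close> and \<open>det (R Y)\<close> occur
    on both sides and cancel in an integral domain.\<close>
  ultimately have "det (R ?D) = 1" by (simp add: mult.commute mult.left_commute)
  then have "(\<Prod>j<n. if d j = d i then d i else 1) = 1" by (simp add: RD det_mat_diag)
  moreover have "(\<Prod>j<n. if d j = d i then d i else 1) = d i ^ card {j. j < n \<and> d j = d i}"
    by (simp add: prod.If_cases lessThan_def Int_def)
  ultimately show ?thesis by simp
qed

lemma mat_diag_pow: "mat_diag n d ^\<^sub>m k = mat_diag n (\<lambda>i. d i ^ k)"
  by (induction k) (simp_all add: power_Suc2 carrier_matD[OF mat_diag_dim] del: power_Suc)

text \<open>The order of each eigenvalue divides its multiplicity, a number between 1 and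
  \<open>n\<close>, so \<open>fact n\<close> is an exponent common to all of them.\<close>

lemma central_commutator_mat_diag_finite_order:
  fixes d :: "nat \<Rightarrow> 'a :: idom"
  assumes "X \<in> carrier_mat n n" "Y \<in> carrier_mat n n" "X' \<in> carrier_mat n n" "Y' \<in> carrier_mat n n"
    and "X' * X = 1\<^sub>m n" "Y' * Y = 1\<^sub>m n"
    and "mat_diag n d * X = X * mat_diag n d" and "mat_diag n d * Y = Y * mat_diag n d"
    and "X * Y = mat_diag n d * Y * X"
  shows "mat_diag n d ^\<^sub>m fact n = 1\<^sub>m n"
proof -
  have "d i ^ fact n = 1" if i: "i < n" for i
  proof -
    let ?c = "card {j. j < n \<and> d j = d i}"
    have "?c \<le> n" using card_mono[of "{..<n}" "{j. j < n \<and> d j = d i}"] by auto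
    moreover have "?c \<noteq> 0" using i by auto
    ultimately have "?c dvd fact n" by (intro dvd_fact) linarith+
    then obtain q where "fact n = ?c * q" by (elim dvdE)
    then show ?thesis
      using central_commutator_mat_diag_root_of_unity[OF assms i] by (simp add: power_mult)
  qed
  then show ?thesis unfolding mat_diag_pow by (intro eq_matI) (auto simp: mat_diag_def)
qed

lemma central_commutator_diagonalizable_finite_order:
  assumes car: "X \<in> carrier_mat n n" "Y \<in> carrier_mat n n" "X' \<in> carrier_mat n n" "Y' \<in> carrier_mat n n"
      "Z \<in> carrier_mat n n"
    and inv: "X' * X = 1\<^sub>m n" "Y' * Y = 1\<^sub>m n"
    and comm: "Z * X = X * Z" "Z * Y = Y * Z" "X * Y = Z * Y * X"
    and Z: "diagonalizable Z"
  shows "Z ^\<^sub>m fact n = 1\<^sub>m n"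
proof -
  obtain D S T where D: "diagonal_mat D" and w: "similar_mat_wit Z D S T"
    using Z by (auto simp: diagonalizable_def similar_mat_def)
  note W = similar_mat_witD2[OF car(5) w]
  have [simp]: "S \<in> carrier_mat n n" "T \<in> carrier_mat n n" using W by auto
  \<comment> \<open>Conjugation into an eigenbasis of \<open>Z\<close>: it is multiplicative because
    \<open>S * T = 1\<^sub>m n\<close>, and it sends \<open>Z = S * D * T\<close> to
    \<open>D\<close>. Every relation among the given matrices thus passes to their images, reducing
    to a diagonal \<open>Z\<close>.\<close>
  define C where "C A = T * A * S" for A
  have C_car: "C A \<in> carrier_mat n n" if "A \<in> carrier_mat n n" for A
    using that by (simp add: C_def mult_carrier_mat[of _ n n _ n])
  have C_mult: "C (A * B) = C A * C B" if A: "A \<in> carrier_mat n n" and B: "B \<in> carrier_mat n n" for A B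
  proof -
    have "C A * C B = T * A * (S * T) * B * S"
      unfolding C_def using A B
      by (simp add: assoc_mult_mat[of _ n n _ n _ n] mult_carrier_mat[of _ n n _ n])
    also have "\<dots> = T * (A * B) * S"
      using A B unfolding W(1) by (simp add: assoc_mult_mat[of _ n n _ n _ n] mult_carrier_mat[of _ n n _ n])
    finally show ?thesis by (simp add: C_def)
  qed
  have C_one: "C (1\<^sub>m n) = 1\<^sub>m n" using W by (simp add: C_def left_mult_one_mat[of _ n n] right_mult_one_mat[of _ n n])
  have "C Z = T * S * D * (T * S)"
    unfolding C_def W(3) using W(5-7)
    by (simp add: assoc_mult_mat[of _ n n _ n _ n] mult_carrier_mat[of _ n n _ n])
  then have CZ: "C Z = D" using W by simp
  define d where "d i = D $$ (i,i)" for i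
  have Dd: "mat_diag n d = D"
    unfolding d_def using D W(5) by (intro eq_matI) (auto simp: diagonal_mat_def mat_diag_def)
  \<comment> \<open>Writing the diagonal matrix as \<open>C Z\<close> makes each premise the image
    under \<open>C\<close> of an assumed relation.\<close>
  have "mat_diag n d ^\<^sub>m fact n = 1\<^sub>m n"
    by (rule central_commutator_mat_diag_finite_order[of "C X" _ "C Y" "C X'" "C Y'"],
        unfold Dd CZ[symmetric])
      (use car inv comm C_one in
        \<open>simp_all add: C_car C_mult[symmetric] mult_carrier_mat[of _ n n _ n]\<close>)
  then have Dk: "D ^\<^sub>m fact n = 1\<^sub>m n" using Dd by simp
  \<comment> \<open>Back in the original basis: a matrix similar to the identity is the
    identity.\<close>
  have "similar_mat_wit (Z ^\<^sub>m fact n) (D ^\<^sub>m fact n) S T"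
    by (rule similar_mat_wit_pow[OF w])
  then have "Z ^\<^sub>m fact n = S * 1\<^sub>m n * T"
    unfolding Dk by (simp add: similar_mat_wit_def Let_def)
  then show ?thesis using W by simp
qed

theorem lemma3p4:
  fixes n :: nat and G :: "complex mat set"
  assumes "subgroup G (GL n)"
    and "nilpotent_group ((GL n)\<lparr>carrier := G\<rparr>)"
    and "torsion_free_group ((GL n)\<lparr>carrier := G\<rparr>)"
    and "\<not> comm_group ((GL n)\<lparr>carrier := G\<rparr>)"
  shows "\<exists>A \<in> G. \<not> diagonalizable A"
proof -
  let ?H = "(GL n)\<lparr>carrier := G\<rparr>"
  interpret H: group ?H using assms(2) by (simp add: nilpotent_group_def)
  have mult: "A \<otimes>\<^bsub>?H\<^esub> B = A * B" for A B by (simp add: GL_def units_of_mult ring_mat_simps)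
  have one: "\<one>\<^bsub>?H\<^esub> = 1\<^sub>m n" by (simp add: GL_def units_of_one ring_mat_simps)
  have car: "A \<in> carrier_mat n n" if "A \<in> carrier ?H" for A
    using that subgroup.subset[OF assms(1)] by (auto simp: carrier_GL)
  have pow: "A [^]\<^bsub>?H\<^esub> k = A ^\<^sub>m k" if "A \<in> carrier ?H" for A and k :: nat
    using car[OF that] by (induction k) (simp_all only: H.nat_pow_0 H.nat_pow_Suc mult one pow_mat.simps, simp)
  obtain x y z where xyz: "x \<in> carrier ?H" "y \<in> carrier ?H" "z \<in> carrier ?H" "z \<noteq> \<one>\<^bsub>?H\<^esub>"
    "x \<otimes>\<^bsub>?H\<^esub> y = z \<otimes>\<^bsub>?H\<^esub> y \<otimes>\<^bsub>?H\<^esub> x" "\<And>g. g \<in> carrier ?H \<Longrightarrow> z \<otimes>\<^bsub>?H\<^esub> g = g \<otimes>\<^bsub>?H\<^esub> z"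
    using nilpotent_group_obtain_central_commutator[OF assms(2,4)] by blast
  \<comment> \<open>The nontrivial central commutator is the witness. If it were diagonalizable, its
    power with the positive exponent \<open>fact n\<close> would be trivial, contradicting
    torsion-freeness.\<close>
  have "\<not> diagonalizable z"
  proof
    assume "diagonalizable z"
    then have "z ^\<^sub>m fact n = 1\<^sub>m n"
      using central_commutator_diagonalizable_finite_order[OF car[OF xyz(1)] car[OF xyz(2)]
          car[OF H.inv_closed[OF xyz(1)]] car[OF H.inv_closed[OF xyz(2)]] car[OF xyz(3)]]
        H.l_inv[OF xyz(1)] H.l_inv[OF xyz(2)]
        xyz(5) xyz(6)[OF xyz(1)] xyz(6)[OF xyz(2)]
      unfolding mult one by blast
    then have "z [^]\<^bsub>?H\<^esub> (fact n :: nat) = \<one>\<^bsub>?H\<^esub>" using pow[OF xyz(3)] one by simp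
    moreover have "(fact n :: nat) > 0" by simp
    ultimately show False
      using assms(3) xyz(3,4) unfolding torsion_free_group_def by blast
  qed
  then show ?thesis using xyz(3) by auto
qed

end
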